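(* Let $X$ be a compact Hausdorff space and $\alpha:X\to X$ a continuous map with $\sup_{x\in X}|\alpha^{-1}(x)|<\infty$. Let $A:C(X)\to C(X)$ be a transfer operator of the form $$[Af](x)=\sum_{y\in\alpha^{-1}(x)}\rho(y)f(y),\qquad f\in C(X),\ x\in X,$$ where $\rho$ is a nonnegative function on $X$ (not assumed continuous). Let $x_0\in X$. Then a) if $\rho(x_0)=0$ then $\rho$ is continuous at $x_0$; b) if $\rho(x_0)\ne0$ then $\rho$ is continuous at $x_0$ if and only if $x_0$ is a local injectivity point; c) if $\rho(x_0)\ne0$ then $x_0$ is a local openness point; d) if $\rho(x_0)\ne0$ then $x_0$ is a local injectivity point if and only if it is a local homeomorphism point.
   Context: A transfer operator for $(X,\alpha)$ is a positive linear operator $A:C(X)\to C(X)$ with $A((f\circ\alpha)g)=f\,Ag$ for all $f,g\in C(X)$. A point $x\in X$ is called: a local injectivity point if there is a neighborhood $U$ of $x$ such that $\alpha|_U$ is injective; a local openness point if for every neighborhood $U$ of $x$ the image $\alpha(U)$ contains a neighborhood of $\alpha(x)$; a local homeomorphism point if there are neighborhoods of $x$ and of $\alpha(x)$ such that $\alpha$ maps the former homeomorphically onto the latter. *)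

theory Defs
  imports "HOL-Analysis.Analysis"
begin

text \<open>
  The scalar type variable stands for an arbitrary \<^class>\<open>real_normed_field\<close>, so both the real and
  the complex algebra of continuous functions are covered. Being a nonnegative function means
  taking values in \<^const>\<open>nonneg_Reals\<close>.
\<close>

definition cont_funs :: "('a::topological_space \<Rightarrow> 'k::real_normed_field) set" where
  "cont_funs = {f. continuous_on UNIV f}"

text \<open>
  An operator is a total function on all functions, but only its values on \<^const>\<open>cont_funs\<close> matter.
\<close>

definition transfer_operator ::
  "('a::topological_space \<Rightarrow> 'a) \<Rightarrow> (('a \<Rightarrow> 'k::real_normed_field) \<Rightarrow> ('a \<Rightarrow> 'k)) \<Rightarrow> bool" where
  "transfer_operator \<alpha> A \<longleftrightarrow>
     A \<in> cont_funs \<rightarrow> cont_funs \<and>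
     (\<forall>f\<in>cont_funs. \<forall>g\<in>cont_funs. A (\<lambda>x. f x + g x) = (\<lambda>x. A f x + A g x)) \<and>
     (\<forall>c. \<forall>f\<in>cont_funs. A (\<lambda>x. c * f x) = (\<lambda>x. c * A f x)) \<and>
     (\<forall>f\<in>cont_funs. (\<forall>x. f x \<in> \<real>\<^sub>\<ge>\<^sub>0) \<longrightarrow> (\<forall>x. A f x \<in> \<real>\<^sub>\<ge>\<^sub>0)) \<and>
     (\<forall>f\<in>cont_funs. \<forall>g\<in>cont_funs. A (\<lambda>x. (f \<circ> \<alpha>) x * g x) = (\<lambda>x. f x * A g x))"

definition local_injectivity_point ::
  "('a::topological_space \<Rightarrow> 'a) \<Rightarrow> 'a \<Rightarrow> bool" where
  "local_injectivity_point \<alpha> x \<longleftrightarrow> (\<exists>U. open U \<and> x \<in> U \<and> inj_on \<alpha> U)"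

definition local_openness_point ::
  "('a::topological_space \<Rightarrow> 'a) \<Rightarrow> 'a \<Rightarrow> bool" where
  "local_openness_point \<alpha> x \<longleftrightarrow>
     (\<forall>U. open U \<and> x \<in> U \<longrightarrow> (\<exists>V. open V \<and> \<alpha> x \<in> V \<and> V \<subseteq> \<alpha> ` U))"

definition local_homeomorphism_point ::
  "('a::topological_space \<Rightarrow> 'a) \<Rightarrow> 'a \<Rightarrow> bool" where
  "local_homeomorphism_point \<alpha> x \<longleftrightarrow>
     (\<exists>U V g. open U \<and> x \<in> U \<and> open V \<and> \<alpha> x \<in> V \<and> homeomorphism U V \<alpha> g)"

end

theory Submission
  imports Defs
begin

text \<open>
  If a bump function \<open>f \<ge> 0\<close> equals \<open>1\<close> at \<open>x0\<close> and vanishes at the other points of the fibre of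
  \<open>\<alpha> x0\<close>, then \<open>A f (\<alpha> x0) = \<rho> x0\<close>, while \<open>\<rho> x * f x \<le> A f (\<alpha> x)\<close> for all \<open>x\<close>. Since \<open>A f \<circ> \<alpha>\<close> is
  continuous, this bounds \<open>\<rho>\<close> from above near \<open>x0\<close>. Two distinct points near \<open>x0\<close> with the same
  image would each contribute almost \<open>\<rho> x0\<close> to \<open>A f\<close> if \<open>\<rho>\<close> were continuous, which is too much.
  If \<open>\<alpha>\<close> is injective on the support of \<open>f\<close>, then \<open>\<rho> = (A f \<circ> \<alpha>) / f\<close> near \<open>x0\<close>. For an arbitrary bump
  function \<open>f\<close> at \<open>x0\<close>, the open set \<open>{A f > 0}\<close> lies in the image of the support of \<open>f\<close>; it contains
  \<open>\<alpha> x0\<close> when \<open>\<rho> x0 > 0\<close>, which gives local openness. If moreover \<open>\<alpha>\<close> is injective on that support,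
  then \<open>\<rho> > 0\<close> at every point of it mapped into \<open>{A f > 0}\<close>, so \<open>\<alpha>\<close> is open there and hence a
  homeomorphism onto \<open>{A f > 0}\<close>.
\<close>

lemma completely_regular_bump:
  fixes x :: "'a::topological_space"
  assumes "completely_regular_space (euclidean :: 'a topology)" "open U" "x \<in> U"
  obtains f :: "'a \<Rightarrow> real" where "continuous_on UNIV f" "\<And>y. f y \<ge> 0" "f x = 1"
    "\<And>y. y \<notin> U \<Longrightarrow> f y = 0"
proof -
  have "\<forall>S x. openin euclidean S \<longrightarrow> x \<in> S \<longrightarrow>
      (\<exists>f :: 'a \<Rightarrow> real. continuous_map euclidean euclidean f \<and> f x = 1 \<and>
        f ` (topspace euclidean - S) \<subseteq> {0})"
    using assms(1) completely_regular_space_gen_alt'[of 1 0 "euclidean :: 'a topology"] by simp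
  then have "\<exists>f :: 'a \<Rightarrow> real. continuous_on UNIV f \<and> f x = 1 \<and> f ` (- U) \<subseteq> {0}"
    using assms(2,3) by (simp add: Compl_eq_Diff_UNIV)
  then obtain f :: "'a \<Rightarrow> real" where f: "continuous_on UNIV f" "f x = 1" "f ` (- U) \<subseteq> {0}"
    by blast
  \<comment> \<open>The separating function supplied by complete regularity may change sign; its
    absolute value is nonnegative and keeps the values 1 and 0.\<close>
  show thesis
    by (rule that[of "\<lambda>y. \<bar>f y\<bar>"]) (use f in \<open>auto intro!: continuous_intros\<close>)
qed

lemma isCont_eventually_nhds:
  fixes f :: "'a::t2_space \<Rightarrow> 'b::linorder_topology"
  assumes "isCont f x"
  shows "a < f x \<Longrightarrow> \<forall>\<^sub>F y in nhds x. a < f y"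
    and "f x < a \<Longrightarrow> \<forall>\<^sub>F y in nhds x. f y < a"
  using assms unfolding isCont_def tendsto_at_iff_tendsto_nhds by (blast intro: order_tendstoD)+

text \<open>The real counterpart of the operator \<open>A\<close>: it lets all estimates take place
  in the ordered field of reals, whatever the scalar type of \<open>A\<close> is.\<close>

definition fibre_sum :: "('a \<Rightarrow> 'b) \<Rightarrow> ('a \<Rightarrow> real) \<Rightarrow> ('a \<Rightarrow> real) \<Rightarrow> 'b \<Rightarrow> real" where
  "fibre_sum \<alpha> \<rho> f z = (\<Sum>y\<in>\<alpha> -` {z}. \<rho> y * f y)"

text \<open>Continuity is asked for nonnegative functions, as it is for these that it can be read
  off from the norm of \<open>A\<close>; all bump functions below are of this kind.\<close>

locale continuous_fibre_sum =
  fixes \<alpha> :: "'a::t2_space \<Rightarrow> 'a" and \<rho> :: "'a \<Rightarrow> real"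
  assumes completely_regular: "completely_regular_space (euclidean :: 'a topology)"
    and cont_map: "continuous_on UNIV \<alpha>"
    and finite_fibre: "\<And>z. finite (\<alpha> -` {z})"
    and weight_nonneg: "\<And>x. \<rho> x \<ge> 0"
    and cont_fibre_sum:
      "\<And>f. continuous_on UNIV f \<Longrightarrow> (\<And>x. f x \<ge> 0) \<Longrightarrow> continuous_on UNIV (fibre_sum \<alpha> \<rho> f)"
begin

lemma sum_le_fibre_sum:
  assumes "\<And>x. f x \<ge> 0" "S \<subseteq> \<alpha> -` {z}"
  shows "(\<Sum>y\<in>S. \<rho> y * f y) \<le> fibre_sum \<alpha> \<rho> f z"
  unfolding fibre_sum_def
  by (rule sum_mono2) (use assms finite_fibre weight_nonneg in auto)

lemma weight_mult_le_fibre_sum: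
  assumes "\<And>x. f x \<ge> 0"
  shows "\<rho> x * f x \<le> fibre_sum \<alpha> \<rho> f (\<alpha> x)"
  using sum_le_fibre_sum[OF assms, of "{x}" "\<alpha> x"] by simp

lemma fibre_sum_eq_weight_mult:
  assumes "\<And>y. \<alpha> y = \<alpha> x \<Longrightarrow> y \<noteq> x \<Longrightarrow> f y = 0"
  shows "fibre_sum \<alpha> \<rho> f (\<alpha> x) = \<rho> x * f x"
proof -
  have "(\<Sum>y\<in>{x}. \<rho> y * f y) = (\<Sum>y\<in>\<alpha> -` {\<alpha> x}. \<rho> y * f y)"
    by (rule sum.mono_neutral_left) (use assms finite_fibre in auto)
  then show ?thesis
    by (simp add: fibre_sum_def)
qed

lemma isCont_fibre_sum_comp:
  assumes "continuous_on UNIV f" "\<And>x. f x \<ge> 0"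
  shows "isCont (\<lambda>x. fibre_sum \<alpha> \<rho> f (\<alpha> x)) x"
proof -
  have "continuous_on UNIV (\<lambda>x. fibre_sum \<alpha> \<rho> f (\<alpha> x))"
    by (rule continuous_on_compose2[OF cont_fibre_sum[OF assms] cont_map]) auto
  then show ?thesis
    by (simp add: continuous_on_eq_continuous_at)
qed

lemma fibre_bump:
  obtains f where "continuous_on UNIV f" "\<And>y. f y \<ge> 0" "f x = 1"
    "fibre_sum \<alpha> \<rho> f (\<alpha> x) = \<rho> x"
proof -
  \<comment> \<open>The fibre is finite, hence closed in a Hausdorff space even after removing
    \<open>x\<close>, so a neighborhood of \<open>x\<close> avoids its other points.\<close>
  let ?U = "- (\<alpha> -` {\<alpha> x} - {x})"
  have U: "open ?U" "x \<in> ?U"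
    using finite_fibre[of "\<alpha> x"] by (simp_all add: open_Compl finite_imp_closed del: Compl_Diff_eq)
  obtain f :: "'a \<Rightarrow> real" where f: "continuous_on UNIV f" "\<And>y. f y \<ge> 0" "f x = 1"
    "\<And>y. y \<notin> ?U \<Longrightarrow> f y = 0"
    by (rule completely_regular_bump[OF completely_regular U]) (rule that)
  have "fibre_sum \<alpha> \<rho> f (\<alpha> x) = \<rho> x * f x"
    by (rule fibre_sum_eq_weight_mult) (use f(4) in auto)
  with f(3) show thesis
    by (intro that[OF f(1,2)]) simp_all
qed

lemma isCont_weight_zero:
  assumes "\<rho> x = 0"
  shows "isCont \<rho> x"
proof -
  obtain f :: "'a \<Rightarrow> real" where f: "continuous_on UNIV f" "\<And>y. f y \<ge> 0" "f x = 1"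
    "fibre_sum \<alpha> \<rho> f (\<alpha> x) = \<rho> x"
    by (rule fibre_bump[of x]) (rule that)
  have f_lim: "(f \<longlongrightarrow> 1) (at x)"
    using f(1,3) by (metis UNIV_I continuous_on_def)
  have "((\<lambda>y. fibre_sum \<alpha> \<rho> f (\<alpha> y)) \<longlongrightarrow> 0) (at x)"
    using isCont_fibre_sum_comp[OF f(1,2), of x] f(4) assms by (simp add: isCont_def)
  then have lim: "((\<lambda>y. fibre_sum \<alpha> \<rho> f (\<alpha> y) / f y) \<longlongrightarrow> 0) (at x)"
    using tendsto_divide[OF _ f_lim] by fastforce
  have "\<forall>\<^sub>F y in at x. f y > 0"
    using f_lim by (rule order_tendstoD) simp
  \<comment> \<open>Where \<open>f\<close> is positive, \<rho> is squeezed between 0 and a quotient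
    that tends to \<rho> x = 0.\<close>
  then have "\<forall>\<^sub>F y in at x. \<rho> y \<le> fibre_sum \<alpha> \<rho> f (\<alpha> y) / f y"
    by eventually_elim (use weight_mult_le_fibre_sum[OF f(2)] in \<open>simp add: field_simps\<close>)
  then have "(\<rho> \<longlongrightarrow> 0) (at x)"
    by (intro tendsto_sandwich[OF _ _ tendsto_const lim]) (use weight_nonneg in auto)
  with assms show ?thesis
    by (simp add: isCont_def)
qed

lemma isCont_weight_if_inj:
  assumes "local_injectivity_point \<alpha> x"
  shows "isCont \<rho> x"
proof -
  obtain U where U: "open U" "x \<in> U" "inj_on \<alpha> U"
    using assms unfolding local_injectivity_point_def by blast
  obtain f :: "'a \<Rightarrow> real" where f: "continuous_on UNIV f" "\<And>y. f y \<ge> 0" "f x = 1" "\<And>y. y \<notin> U \<Longrightarrow> f y = 0"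
    by (rule completely_regular_bump[OF completely_regular U(1,2)]) (rule that)
  have f_cont: "isCont f x"
    using f(1) by (simp add: continuous_on_eq_continuous_at)
  have cont: "isCont (\<lambda>y. fibre_sum \<alpha> \<rho> f (\<alpha> y) / f y) x"
    using isCont_fibre_sum_comp[OF f(1,2), of x] f_cont f(3) by (auto intro!: continuous_intros)
  \<comment> \<open>The filter is \<open>nhds x\<close>, because \<open>isCont_cong\<close> compares
    the values at \<open>x\<close> as well.\<close>
  have "\<forall>\<^sub>F y in nhds x. f y > 0"
    by (rule isCont_eventually_nhds[OF f_cont]) (simp add: f(3))
  moreover have "\<forall>\<^sub>F y in nhds x. y \<in> U"
    using U eventually_nhds by blast
  ultimately have "\<forall>\<^sub>F y in nhds x. fibre_sum \<alpha> \<rho> f (\<alpha> y) / f y = \<rho> y"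
  proof eventually_elim
    fix y assume "f y > 0" "y \<in> U"
    moreover have "fibre_sum \<alpha> \<rho> f (\<alpha> y) = \<rho> y * f y"
      by (rule fibre_sum_eq_weight_mult) (metis U(3) \<open>y \<in> U\<close> f(4) inj_onD)
    ultimately show "fibre_sum \<alpha> \<rho> f (\<alpha> y) / f y = \<rho> y"
      by simp
  qed
  from isCont_cong[OF this] cont show ?thesis
    by simp
qed

lemma inj_if_isCont_weight:
  assumes "\<rho> x \<noteq> 0" "isCont \<rho> x"
  shows "local_injectivity_point \<alpha> x"
proof -
  have pos: "\<rho> x > 0"
    using assms(1) weight_nonneg[of x] by simp
  obtain f :: "'a \<Rightarrow> real" where f: "continuous_on UNIV f" "\<And>y. f y \<ge> 0" "f x = 1"
    "fibre_sum \<alpha> \<rho> f (\<alpha> x) = \<rho> x"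
    by (rule fibre_bump[of x]) (rule that)
  have "isCont f x"
    using f(1) by (simp add: continuous_on_eq_continuous_at)
  with assms(2) have cont_prod: "isCont (\<lambda>y. \<rho> y * f y) x"
    by (intro continuous_intros)
  \<comment> \<open>The constants satisfy 3/4 + 3/4 > 5/4, so the fibre sum has no room for two such
    terms.\<close>
  have "\<forall>\<^sub>F y in nhds x. \<rho> y * f y > 3/4 * \<rho> x"
    by (rule isCont_eventually_nhds[OF cont_prod]) (use f(3) pos in simp)
  moreover have "\<forall>\<^sub>F y in nhds x. fibre_sum \<alpha> \<rho> f (\<alpha> y) < 5/4 * \<rho> x"
    by (rule isCont_eventually_nhds[OF isCont_fibre_sum_comp[OF f(1,2)]]) (use f(4) pos in simp)
  ultimately have "\<forall>\<^sub>F y in nhds x. \<rho> y * f y > 3/4 * \<rho> x \<and> fibre_sum \<alpha> \<rho> f (\<alpha> y) < 5/4 * \<rho> x"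
    by (rule eventually_conj)
  then obtain U where U: "open U" "x \<in> U"
    "\<And>y. y \<in> U \<Longrightarrow> \<rho> y * f y > 3/4 * \<rho> x \<and> fibre_sum \<alpha> \<rho> f (\<alpha> y) < 5/4 * \<rho> x"
    unfolding eventually_nhds by blast
  have "inj_on \<alpha> U"
  proof (rule inj_onI, rule ccontr)
    fix y z assume yz: "y \<in> U" "z \<in> U" "\<alpha> y = \<alpha> z" "y \<noteq> z"
    have "\<rho> y * f y + \<rho> z * f z \<le> fibre_sum \<alpha> \<rho> f (\<alpha> y)"
      using sum_le_fibre_sum[OF f(2), of "{y, z}" "\<alpha> y"] yz by simp
    with U(3)[OF yz(1)] U(3)[OF yz(2)] pos show False
      by linarith
  qed
  with U show ?thesis
    unfolding local_injectivity_point_def by blast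
qed

text \<open>A positive fibre sum has a nonzero term, and its factor \<open>f\<close> places the
  point in \<open>U\<close>. That this point has nonzero weight is recorded for the homeomorphism
  statement.\<close>

lemma fibre_sum_pos_nhd:
  assumes "\<rho> x \<noteq> 0" "open U" "x \<in> U"
  obtains V where "open V" "\<alpha> x \<in> V" "V \<subseteq> \<alpha> ` U" "\<And>y. \<alpha> y \<in> V \<Longrightarrow> \<exists>z\<in>U. \<alpha> z = \<alpha> y \<and> \<rho> z \<noteq> 0"
proof -
  obtain f :: "'a \<Rightarrow> real" where f: "continuous_on UNIV f" "\<And>y. f y \<ge> 0" "f x = 1" "\<And>y. y \<notin> U \<Longrightarrow> f y = 0"
    by (rule completely_regular_bump[OF completely_regular assms(2,3)]) (rule that)
  define V where "V = {z. fibre_sum \<alpha> \<rho> f z > 0}"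
  have V: "\<exists>y\<in>U. \<alpha> y = z \<and> \<rho> y \<noteq> 0" if "z \<in> V" for z
  proof -
    have "(\<Sum>y\<in>\<alpha> -` {z}. \<rho> y * f y) \<noteq> 0"
      using that by (simp add: V_def fibre_sum_def)
    then obtain y where "y \<in> \<alpha> -` {z}" "\<rho> y * f y \<noteq> 0"
      by (rule sum.not_neutral_contains_not_neutral)
    with f(4) show ?thesis
      by auto
  qed
  have "open V"
    unfolding V_def using cont_fibre_sum[OF f(1,2)] by (intro open_Collect_less continuous_intros)
  moreover have "\<alpha> x \<in> V"
    using weight_mult_le_fibre_sum[of f x, OF f(2)] f(3) assms(1) weight_nonneg[of x]
    by (simp add: V_def)
  ultimately show thesis
    using that V by blast
qed

lemma local_openness:
  assumes "\<rho> x \<noteq> 0"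
  shows "local_openness_point \<alpha> x"
  unfolding local_openness_point_def
proof (intro allI impI, elim conjE)
  fix U assume "open U" "x \<in> U"
  with assms show "\<exists>V. open V \<and> \<alpha> x \<in> V \<and> V \<subseteq> \<alpha> ` U"
    by (rule fibre_sum_pos_nhd) blast
qed

lemma local_homeomorphism_if_inj:
  assumes "\<rho> x \<noteq> 0" "local_injectivity_point \<alpha> x"
  shows "local_homeomorphism_point \<alpha> x"
proof -
  obtain U where U: "open U" "x \<in> U" "inj_on \<alpha> U"
    using assms(2) unfolding local_injectivity_point_def by blast
  obtain V where V: "open V" "\<alpha> x \<in> V" "V \<subseteq> \<alpha> ` U"
    "\<And>y. \<alpha> y \<in> V \<Longrightarrow> \<exists>z\<in>U. \<alpha> z = \<alpha> y \<and> \<rho> z \<noteq> 0"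
    using fibre_sum_pos_nhd[OF assms(1) U(1,2)] by blast
  define W where "W = U \<inter> \<alpha> -` V"
  have "open W"
    unfolding W_def using U(1) V(1) cont_map by (simp add: open_Int open_vimage)
  \<comment> \<open>Injectivity on \<open>U\<close> identifies \<open>y\<close> with the point of
    nonzero weight in \<open>U\<close> that has the same image, so local openness applies at every
    point of \<open>W\<close>.\<close>
  have "\<rho> y \<noteq> 0" if "y \<in> W" for y
    using that V(4)[of y] U(3) by (auto simp: W_def inj_on_def)
  then have opn: "open (\<alpha> ` S)" if "open S" "S \<subseteq> W" for S
    using that local_openness unfolding local_openness_point_def
    by (subst open_subopen) blast
  have "continuous_on W \<alpha>" "\<alpha> ` W = V" "inj_on \<alpha> W"
    using cont_map continuous_on_subset V(3) inj_on_subset[OF U(3)] by (auto simp: W_def)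
  moreover have "openin (top_of_set V) (\<alpha> ` S)" if "openin (top_of_set W) S" for S
    using that opn \<open>open W\<close> \<open>\<alpha> ` W = V\<close> V(1) by (auto simp: openin_open_eq)
  ultimately obtain g where "homeomorphism W V \<alpha> g"
    using homeomorphism_injective_open_map by blast
  moreover have "x \<in> W"
    using U(2) V(2) by (simp add: W_def)
  ultimately show ?thesis
    unfolding local_homeomorphism_point_def using \<open>open W\<close> V(1,2) by blast
qed

end

lemma local_injectivity_if_homeomorphism:
  "local_homeomorphism_point \<alpha> x \<Longrightarrow> local_injectivity_point \<alpha> x"
  unfolding local_homeomorphism_point_def local_injectivity_point_def homeomorphism_def
  by (blast intro: inj_on_inverseI)

theorem lemma18:
  fixes \<alpha> :: "'a::t2_space \<Rightarrow> 'a"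
    and A :: "('a \<Rightarrow> 'k::real_normed_field) \<Rightarrow> ('a \<Rightarrow> 'k)"
    and \<rho> :: "'a \<Rightarrow> real"
    and x0 :: 'a
  assumes "compact (UNIV :: 'a set)"
    and "continuous_on UNIV \<alpha>"
    and "\<exists>N::nat. \<forall>x. finite (\<alpha> -` {x}) \<and> card (\<alpha> -` {x}) \<le> N"
    and "transfer_operator \<alpha> A"
    and "\<And>x. \<rho> x \<ge> 0"
    and "\<And>f x. f \<in> cont_funs \<Longrightarrow> A f x = (\<Sum>y\<in>\<alpha> -` {x}. of_real (\<rho> y) * f y)"
  shows "(\<rho> x0 = 0 \<longrightarrow> isCont \<rho> x0) \<and>
         (\<rho> x0 \<noteq> 0 \<longrightarrow> (isCont \<rho> x0 \<longleftrightarrow> local_injectivity_point \<alpha> x0)) \<and>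
         (\<rho> x0 \<noteq> 0 \<longrightarrow> local_openness_point \<alpha> x0) \<and>
         (\<rho> x0 \<noteq> 0 \<longrightarrow>
            (local_injectivity_point \<alpha> x0 \<longleftrightarrow> local_homeomorphism_point \<alpha> x0))"
proof -
  have "compact_space (euclidean :: 'a topology)"
    using assms(1) by (simp add: compact_space_def)
  moreover have "Hausdorff_space (euclidean :: 'a topology)"
    unfolding Hausdorff_space_def by (simp add: disjnt_def separation_t2)
  ultimately have "completely_regular_space (euclidean :: 'a topology)"
    by (simp add: normal_imp_completely_regular_space
        compact_Hausdorff_or_regular_imp_normal_space)
  moreover have "continuous_on UNIV (fibre_sum \<alpha> \<rho> f)"
    if f: "continuous_on UNIV f" "\<And>x. f x \<ge> 0" for f
  proof -
    let ?f = "\<lambda>x. of_real (f x) :: 'k"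
    have "?f \<in> cont_funs"
      using f(1) by (simp add: cont_funs_def continuous_on_of_real)
    then have "A ?f \<in> cont_funs" and A: "A ?f x = of_real (fibre_sum \<alpha> \<rho> f x)" for x
      using assms(4,6) by (auto simp: transfer_operator_def fibre_sum_def)
    \<comment> \<open>The norm undoes \<open>of_real\<close> on nonnegative reals, carrying
      continuity from \<open>'k\<close> back to the real fibre sum.\<close>
    then have "continuous_on UNIV (\<lambda>x. norm (A ?f x))"
      unfolding cont_funs_def by (intro continuous_on_norm) simp
    moreover have "norm (A ?f x) = fibre_sum \<alpha> \<rho> f x" for x
      using f(2) assms(5) by (simp only: A norm_of_real) (simp add: fibre_sum_def sum_nonneg)
    ultimately show ?thesis
      by (simp only:)
  qed
  ultimately interpret continuous_fibre_sum \<alpha> \<rho>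
    using assms(2,3,5) by unfold_locales auto
  show ?thesis
    using isCont_weight_zero[of x0] isCont_weight_if_inj[of x0] inj_if_isCont_weight[of x0]
      local_openness[of x0] local_homeomorphism_if_inj[of x0]
      local_injectivity_if_homeomorphism[of \<alpha> x0] by blast
qed

end
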